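(* Let $(\Omega,\Xi)$ be a measurable space and let $G$ be a $\sigma$-finite kernel on $\Omega$ satisfying the weak maximum principle with constant $\mathfrak{b}\ge1$. Let $g:[0,1]\to[1,+\infty]$ be a continuous monotone non-increasing function, finite on $(0,1]$, and set $$F(t)=\int_t^1\frac{ds}{g(s)},\qquad 0\le t\le1 .$$ If a measurable function $u\ge0$ on $\Omega$ satisfies $$u(x)+G(g(u))(x)\le1\quad\text{for all }x\in\Omega,$$ then, for all $x\in\Omega$ such that $u(x)>0$, the following inequalities hold: $$u(x)\ \le\ 1-\mathfrak{b}\left[1-F^{-1}\big(\mathfrak{b}^{-1}G1(x)\big)\right]$$ and $$\mathfrak{b}^{-1}G1(x)\ <\ F(1-\mathfrak{b}^{-1})=\int_{1-\mathfrak{b}^{-1}}^1\frac{ds}{g(s)},$$ so that the right-hand side of the first inequality is well-defined and positive.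
   Context: A $\sigma$-finite kernel $G(x,dy)$ on $(\Omega,\Xi)$: for each $x\in\Omega$, $G(x,dy)$ is a $\sigma$-finite measure on $(\Omega,\Xi)$, and for every $\Xi$-measurable $f:\Omega\to[0,\infty]$ the function $Gf(x)=\int_\Omega f(y)\,G(x,dy)$ is $\Xi$-measurable. $G1$ is $Gf$ with $f\equiv1$. Weak maximum principle with constant $\mathfrak{b}\ge1$: for any non-negative bounded measurable function $f$ on $\Omega$, if $Gf\le1$ in $\{f>0\}$, then $Gf\le\mathfrak{b}$ in $\Omega$. Note $0\le u\le1$ automatically; $g(0)=\lim_{t\to0^+}g(t)\le+\infty$. $F^{-1}:[0,F(0)]\to[0,1]$ is the inverse of the strictly decreasing function $F:[0,1]\to[0,F(0)]$. *)

theory Defs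
  imports "HOL-Analysis.Analysis"
begin

text \<open>Throughout, \<open>M\<close> only serves as the measurable space \<open>(\<Omega>, \<Xi>) = (space M, sets M)\<close>;
  its measure is irrelevant, and the values of a kernel outside \<open>space M\<close> are never used.\<close>

definition kernel_app :: "('a \<Rightarrow> 'a measure) \<Rightarrow> ('a \<Rightarrow> ennreal) \<Rightarrow> 'a \<Rightarrow> ennreal" where
  "kernel_app G f x = (\<integral>\<^sup>+ y. f y \<partial>G x)"

definition sigma_finite_kernel :: "'a measure \<Rightarrow> ('a \<Rightarrow> 'a measure) \<Rightarrow> bool" where
  "sigma_finite_kernel M G \<longleftrightarrow>
     (\<forall>x\<in>space M. sets (G x) = sets M \<and> sigma_finite_measure (G x)) \<and>
     (\<forall>f\<in>borel_measurable M. kernel_app G f \<in> borel_measurable M)"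

definition weak_max_principle :: "'a measure \<Rightarrow> ('a \<Rightarrow> 'a measure) \<Rightarrow> real \<Rightarrow> bool" where
  "weak_max_principle M G b \<longleftrightarrow>
     (\<forall>f :: 'a \<Rightarrow> real.
        f \<in> borel_measurable M \<longrightarrow>
        (\<forall>x\<in>space M. 0 \<le> f x) \<longrightarrow>
        bounded (f ` space M) \<longrightarrow>
        (\<forall>x\<in>space M. f x > 0 \<longrightarrow> kernel_app G (\<lambda>y. ennreal (f y)) x \<le> 1) \<longrightarrow>
        (\<forall>x\<in>space M. kernel_app G (\<lambda>y. ennreal (f y)) x \<le> ennreal b))"

text \<open>The function \<open>F(t) = \<integral>\<^sub>t\<^sup>1 ds / g(s)\<close>, with \<open>1/\<infinity> = 0\<close>. It is valued in
  \<^typ>\<open>ennreal\<close>, like \<open>G1\<close>, so that the two can be compared without assuming \<open>G1\<close> finite.\<close>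

definition recip_integral :: "(real \<Rightarrow> ennreal) \<Rightarrow> real \<Rightarrow> ennreal" where
  "recip_integral g t = (\<integral>\<^sup>+ s\<in>{t..1}. inverse (g s) \<partial>lborel)"

text \<open>The inverse of \<open>F : [0,1] \<rightarrow> [0,F(0)]\<close>; meaningful only for arguments in \<open>[0,F(0)]\<close>.\<close>

definition recip_integral_inv :: "(real \<Rightarrow> ennreal) \<Rightarrow> ennreal \<Rightarrow> real" where
  "recip_integral_inv g = the_inv_into {0..1} (recip_integral g)"

end

theory Submission
  imports Defs
begin

text \<open>Fix \<open>x\<close> and consider the measure \<open>\<nu>(dy) = g(u(y)) G(x,dy)\<close>, whose total mass is at most
  \<open>1 - u(x)\<close>. On the set \<open>{u \<ge> r}\<close> the potential of \<open>g(u) 1\<^bsub>{u \<ge> r}\<^esub>\<close> is at most \<open>1 - u \<le> 1 - r\<close>,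
  so the weak maximum principle gives \<open>\<nu>{u \<ge> r} \<le> b (1 - r)\<close>. Now \<open>G1(x)\<close> is the \<open>\<nu>\<close>-integral of
  \<open>1/g(u)\<close>, and \<open>1/g\<close> is non-decreasing. Comparing superlevel sets, the worst case allowed by the two
  mass bounds is \<open>b\<close> times Lebesgue measure on \<open>[p, 1]\<close> with \<open>p = 1 - (1 - u(x))/b\<close>. Hence
  \<open>G1(x)/b \<le> F(p)\<close>, and both claims follow because \<open>F\<close> is strictly decreasing and
  \<open>p > 1 - 1/b\<close> when \<open>u(x) > 0\<close>.\<close>

section \<open>Layer-cake representation of nonnegative integrals\<close>

lemma emeasure_lborel_Ici: "emeasure lborel {a::real..} = \<infinity>"
proof (rule ccontr)
  assume "emeasure lborel {a..} \<noteq> \<infinity>"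
  then obtain r where r: "emeasure lborel {a..} = ennreal r" "0 \<le> r"
    by (cases "emeasure lborel {a..}") auto
  have "emeasure lborel {a..a + r + 1} \<le> emeasure lborel {a..}"
    by (intro emeasure_mono) auto
  then show False using r by simp
qed

text \<open>Each value \<open>f x\<close> is the length of the half-open interval from 0 to
  \<open>f x\<close>. Fubini for the indicator of the region under the graph then swaps the two
  integrations; this is where sigma-finiteness of \<open>M\<close> enters.\<close>

lemma nn_integral_layer_cake:
  fixes f :: "'a \<Rightarrow> ennreal"
  assumes "sigma_finite_measure M" and f [measurable]: "f \<in> borel_measurable M"
  shows "(\<integral>\<^sup>+x. f x \<partial>M) = (\<integral>\<^sup>+t\<in>{0..}. emeasure M {x\<in>space M. ennreal t < f x} \<partial>lborel)"
proof -
  interpret sigma_finite_measure M by fact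
  interpret pair_sigma_finite M lborel ..
  have eq: "f x = (\<integral>\<^sup>+t. indicator {t. 0 \<le> t \<and> ennreal t < f x} t \<partial>lborel)" for x
  proof (cases "f x")
    case (real r)
    have "{t. 0 \<le> t \<and> ennreal t < f x} = {0..<r}"
      using real by (auto simp: ennreal_less_iff)
    then show ?thesis using real by simp
  next
    case top
    have "{t. 0 \<le> t \<and> ennreal t < f x} = {0..}"
      using top by auto
    then show ?thesis using top by (simp add: emeasure_lborel_Ici)
  qed
  have "(\<integral>\<^sup>+x. f x \<partial>M)
      = (\<integral>\<^sup>+x. \<integral>\<^sup>+t. indicator {t. 0 \<le> t \<and> ennreal t < f x} t \<partial>lborel \<partial>M)"
    by (subst eq) simp
  also have "\<dots> = (\<integral>\<^sup>+t. \<integral>\<^sup>+x. indicator {t. 0 \<le> t \<and> ennreal t < f x} t \<partial>M \<partial>lborel)"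
    by (rule Fubini'[symmetric]) measurable
  also have "\<dots> = (\<integral>\<^sup>+t\<in>{0..}. emeasure M {x\<in>space M. ennreal t < f x} \<partial>lborel)"
  proof (rule nn_integral_cong)
    fix t :: real
    have "(\<integral>\<^sup>+x. indicator {t. 0 \<le> t \<and> ennreal t < f x} t \<partial>M)
        = (\<integral>\<^sup>+x. indicator {0..} t * indicator {x\<in>space M. ennreal t < f x} x \<partial>M)"
      by (intro nn_integral_cong) (auto split: split_indicator)
    then show "(\<integral>\<^sup>+x. indicator {t. 0 \<le> t \<and> ennreal t < f x} t \<partial>M)
        = emeasure M {x\<in>space M. ennreal t < f x} * indicator {0..} t"
      by (simp add: nn_integral_cmult mult.commute)
  qed
  finally show ?thesis .
qed

section \<open>Order reversal by inverses, and rescaling of the weak maximum principle\<close>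

lemma ennreal_inverse_antimono: "x \<le> y \<Longrightarrow> inverse y \<le> inverse (x::ennreal)"
  by (simp add: less_eq_ennreal.rep_eq inverse_ennreal.rep_eq ereal_inverse_antimono)

text \<open>Homogeneity of the kernel: \<open>f / c\<close> meets the hypothesis at level 1, and
  multiplying by \<open>c\<close> carries the bound back. The level of interest is
  \<open>c = 1 - r\<close>, the bound available on a superlevel set of \<open>u\<close>.\<close>

lemma weak_max_principle_scaled:
  fixes f :: "'a \<Rightarrow> real"
  assumes wmp: "weak_max_principle M G b"
    and ker: "\<And>x. x \<in> space M \<Longrightarrow> sets (G x) = sets M"
    and f [measurable]: "f \<in> borel_measurable M"
    and nonneg: "\<And>x. x \<in> space M \<Longrightarrow> 0 \<le> f x"
    and bdd: "bounded (f ` space M)"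
    and c: "0 < c"
    and le: "\<And>x. x \<in> space M \<Longrightarrow> f x > 0 \<Longrightarrow> kernel_app G (\<lambda>y. ennreal (f y)) x \<le> ennreal c"
    and x: "x \<in> space M"
  shows "kernel_app G (\<lambda>y. ennreal (f y)) x \<le> ennreal (b * c)"
proof -
  have scale: "kernel_app G (\<lambda>y. ennreal (f y)) z
      = ennreal c * kernel_app G (\<lambda>y. ennreal (f y / c)) z" if z: "z \<in> space M" for z
  proof -
    have [measurable]: "f \<in> borel_measurable (G z)"
      using f ker[OF z] by (simp cong: measurable_cong_sets)
    have "kernel_app G (\<lambda>y. ennreal (f y)) z = (\<integral>\<^sup>+y. ennreal c * ennreal (f y / c) \<partial>G z)"
      unfolding kernel_app_def using c by (intro nn_integral_cong) (simp flip: ennreal_mult')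
    then show ?thesis
      by (simp add: kernel_app_def nn_integral_cmult)
  qed
  have "bounded ((\<lambda>y. inverse c *\<^sub>R y) ` f ` space M)"
    using bdd by (rule bounded_scaling)
  then have bdd': "bounded ((\<lambda>y. f y / c) ` space M)"
    by (simp add: image_image divide_inverse mult.commute)
  have one: "kernel_app G (\<lambda>y. ennreal (f y / c)) z \<le> 1" if z: "z \<in> space M" "f z / c > 0" for z
  proof -
    have "ennreal c * kernel_app G (\<lambda>y. ennreal (f y / c)) z \<le> ennreal c * 1"
      using le[of z] z c by (simp add: scale[symmetric] zero_less_divide_iff)
    then show ?thesis
      using c by (subst (asm) ennreal_mult_le_mult_iff) auto
  qed
  have "kernel_app G (\<lambda>y. ennreal (f y / c)) x \<le> ennreal b"
    using wmp[unfolded weak_max_principle_def, rule_format, of "\<lambda>y. f y / c" x] bdd' one nonneg c x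
    by simp
  then have "ennreal c * kernel_app G (\<lambda>y. ennreal (f y / c)) x \<le> ennreal c * ennreal b"
    by (rule mult_left_mono) simp
  then show ?thesis
    using c x by (simp add: scale mult.commute[of b] ennreal_mult')
qed

section \<open>The decreasing function F, its inverse, and comparison of integrals of 1/g\<close>

locale antimono_weight =
  fixes g :: "real \<Rightarrow> ennreal"
  assumes continuous: "continuous_on {0..1} g"
    and antimono: "antimono_on {0..1} g"
    and ge_one: "t \<in> {0..1} \<Longrightarrow> 1 \<le> g t"
    and finite: "t \<in> {0<..1} \<Longrightarrow> g t < \<infinity>"
begin

lemma inverse_mono:
  assumes "0 \<le> s" "s \<le> t" "t \<le> 1" shows "inverse (g s) \<le> inverse (g t)"
  using antimono assms by (intro ennreal_inverse_antimono) (auto simp: monotone_on_def)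

lemma inverse_le_one: "t \<in> {0..1} \<Longrightarrow> inverse (g t) \<le> 1"
  using ennreal_inverse_antimono[OF ge_one] by simp

text \<open>Continuity of \<open>g\<close> is given on the unit interval only, and its values
  elsewhere are arbitrary. Clamping the argument produces a function that is continuous on the whole
  line and agrees with \<open>g\<close> on the interval.\<close>

lemma measurable_clamped: "(\<lambda>s. g (max 0 (min 1 s))) \<in> borel_measurable borel"
  by (intro borel_measurable_continuous_onI continuous_on_compose2[OF continuous] continuous_intros)
    auto

lemma measurable_compose_Icc:
  assumes [measurable]: "u \<in> borel_measurable M" and u: "\<And>x. x \<in> space M \<Longrightarrow> u x \<in> {0..1}"
  shows "(\<lambda>x. g (u x)) \<in> borel_measurable M"
proof -
  have "(\<lambda>x. g (max 0 (min 1 (u x)))) \<in> borel_measurable M"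
    using measurable_clamped by measurable
  moreover have "g (max 0 (min 1 (u x))) = g (u x)" if "x \<in> space M" for x
    using u[OF that] by simp
  ultimately show ?thesis
    by (simp cong: measurable_cong)
qed

lemma measurable_inverse_indicator:
  assumes "A \<subseteq> {0..1}" and [measurable]: "A \<in> sets borel"
  shows "(\<lambda>s. inverse (g s) * indicator A s) \<in> borel_measurable borel"
proof -
  have "(\<lambda>s. inverse (g (max 0 (min 1 s))) * indicator A s) \<in> borel_measurable borel"
    using measurable_clamped by measurable
  also have "(\<lambda>s. inverse (g (max 0 (min 1 s))) * indicator A s)
      = (\<lambda>s. inverse (g s) * indicator A s)"
    using assms(1) by (auto simp: fun_eq_iff subset_eq split: split_indicator)
  finally show ?thesis .
qed

lemma recip_integral_split:
  assumes st: "0 \<le> s" "s \<le> t" "t \<le> 1"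
  shows "recip_integral g s = recip_integral g t + (\<integral>\<^sup>+r\<in>{s..<t}. inverse (g r) \<partial>lborel)"
proof -
  have "recip_integral g s
      = (\<integral>\<^sup>+r. inverse (g r) * indicator {t..1} r + inverse (g r) * indicator {s..<t} r \<partial>lborel)"
    unfolding recip_integral_def
    using st by (intro nn_integral_cong) (auto split: split_indicator)
  also have "\<dots> = recip_integral g t + (\<integral>\<^sup>+r\<in>{s..<t}. inverse (g r) \<partial>lborel)"
    unfolding recip_integral_def
    using st by (intro nn_integral_add) (simp_all add: measurable_inverse_indicator subset_eq)
  finally show ?thesis .
qed

text \<open>The integrand \<open>1/g\<close> is at most 1. Combined with F(1) = 0 this makes F
  finite, and it is also the source of the Lipschitz continuity of F.\<close>

lemma recip_integral_le_add:
  assumes st: "0 \<le> s" "s \<le> t" "t \<le> 1"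
  shows "recip_integral g s \<le> recip_integral g t + ennreal (t - s)"
proof -
  have "(\<integral>\<^sup>+r\<in>{s..<t}. inverse (g r) \<partial>lborel) \<le> (\<integral>\<^sup>+r. indicator {s..<t} r \<partial>lborel)"
    using st inverse_le_one by (intro nn_integral_mono) (auto split: split_indicator)
  then show ?thesis
    using st by (simp add: recip_integral_split[OF st] add_left_mono)
qed

lemma recip_integral_one [simp]: "recip_integral g 1 = 0"
proof -
  have "recip_integral g 1 = (\<integral>\<^sup>+s. inverse (g 1) * indicator {1::real} s \<partial>lborel)"
    unfolding recip_integral_def by (rule nn_integral_cong) (auto split: split_indicator)
  then show ?thesis by (simp add: nn_integral_cmult_indicator)
qed

lemma recip_integral_less_top: "t \<in> {0..1} \<Longrightarrow> recip_integral g t < \<infinity>"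
  using recip_integral_le_add[of t 1] by (auto simp: order_le_less_trans)

lemma recip_integral_strict_antimono:
  assumes st: "0 \<le> s" "s < t" "t \<le> 1"
  shows "recip_integral g t < recip_integral g s"
proof -
  \<comment> \<open>The midpoint is positive even when \<open>s = 0\<close>, where \<open>g\<close>
    may be infinite. Hence \<open>inverse (g m)\<close> is positive, and by monotonicity it bounds
    the integrand from below between \<open>m\<close> and \<open>t\<close>.\<close>
  define m where "m = (s + t) / 2"
  have m: "s < m" "m < t" using st by (auto simp: m_def)
  have "0 < inverse (g m) * ennreal (t - m)"
    using finite[of m] m st by (simp add: ennreal_zero_less_mult_iff ennreal_inverse_positive less_top)
  also have "\<dots> = (\<integral>\<^sup>+r. inverse (g m) * indicator {m..<t} r \<partial>lborel)"
    using m by (simp add: nn_integral_cmult_indicator)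
  also have "\<dots> \<le> (\<integral>\<^sup>+r\<in>{s..<t}. inverse (g r) \<partial>lborel)"
    using m st inverse_mono by (intro nn_integral_mono) (auto split: split_indicator)
  \<comment> \<open>A positive summand gives a strict increase because F(t) is finite.\<close>
  finally show ?thesis
    using st recip_integral_less_top[of t]
    by (subst recip_integral_split[of s t]) (auto simp: less_top)
qed

lemma recip_integral_less_iff:
  assumes "s \<in> {0..1}" "t \<in> {0..1}"
  shows "recip_integral g s < recip_integral g t \<longleftrightarrow> t < s"
  using recip_integral_strict_antimono[of s t] recip_integral_strict_antimono[of t s] assms
  by (cases s t rule: linorder_cases) auto

text \<open>Intermediate value theorem, applied to the real-valued version of F, which is continuous
  because it is 1-Lipschitz.\<close>

lemma recip_integral_surj:
  assumes y: "y \<le> recip_integral g 0"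
  shows "\<exists>t\<in>{0..1}. recip_integral g t = y"
proof -
  define F where "F t = enn2real (recip_integral g t)" for t
  have F: "ennreal (F t) = recip_integral g t" if "t \<in> {0..1}" for t
    using recip_integral_less_top[OF that] by (simp add: F_def)
  have F0: "0 \<le> F t" for t by (simp add: F_def)
  have diff: "\<bar>F t - F s\<bar> \<le> t - s" if st: "0 \<le> s" "s \<le> t" "t \<le> 1" for s t
  proof -
    have "ennreal (F s) \<le> ennreal (F t + (t - s))"
      using recip_integral_le_add[OF st] F[of s] F[of t] st F0[of t] by (simp add: ennreal_plus)
    then have "F s \<le> F t + (t - s)"
      using st F0[of t] by (subst (asm) ennreal_le_iff) auto
    moreover have "F t \<le> F s"
      using recip_integral_less_iff[of s t] st F[of s] F[of t] F0
      by (metis atLeastAtMost_iff ennreal_le_iff linorder_not_le order_trans)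
    ultimately show ?thesis by simp
  qed
  have "1-lipschitz_on {0..1} F"
  proof (rule lipschitz_onI)
    fix s t :: real assume "s \<in> {0..1}" "t \<in> {0..1}"
    then show "dist (F s) (F t) \<le> 1 * dist s t"
      using diff[of s t] diff[of t s] by (cases "s \<le> t") (auto simp: dist_real_def)
  qed simp
  then have cont: "continuous_on {0..1} F"
    by (rule lipschitz_on_continuous_on)
  have "F 1 \<le> enn2real y" by (simp add: F_def)
  moreover have "enn2real y \<le> F 0"
    using y recip_integral_less_top[of 0] unfolding F_def by (intro enn2real_mono) auto
  ultimately obtain t where t: "0 \<le> t" "t \<le> 1" "F t = enn2real y"
    using IVT2'[of F 1 "enn2real y" 0] cont by auto
  \<comment> \<open>As \<open>enn2real\<close> sends \<infinity> to 0, recovering \<open>y\<close>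
    from \<open>enn2real y\<close> requires \<open>y\<close> to be finite.\<close>
  moreover have "y < \<infinity>"
    using y recip_integral_less_top[of 0] by (auto intro: order_le_less_trans)
  ultimately show ?thesis
    using F[of t] by (intro bexI[of _ t]) auto
qed

lemma recip_integral_inv:
  assumes "y \<le> recip_integral g 0"
  shows "recip_integral_inv g y \<in> {0..1}" and "recip_integral g (recip_integral_inv g y) = y"
proof -
  have inj: "inj_on (recip_integral g) {0..1}"
    by (rule inj_onI) (metis less_irrefl linorder_neqE recip_integral_less_iff)
  obtain t where t: "t \<in> {0..1}" "recip_integral g t = y"
    using recip_integral_surj[OF assms] by auto
  then have "recip_integral_inv g y = t"
    unfolding recip_integral_inv_def using inj by (auto intro: the_inv_into_f_eq)
  with t show "recip_integral_inv g y \<in> {0..1}" "recip_integral g (recip_integral_inv g y) = y"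
    by auto
qed

text \<open>By the layer-cake formula it suffices to compare superlevel sets of \<open>1/g\<close>.
  These are intervals ending at 1, since \<open>1/g\<close> is non-decreasing. The two mass bounds
  together say that the \<open>N\<close>-mass of such an interval, pulled back by \<open>u\<close>,
  is at most \<open>b\<close> times the length of its part inside \<open>{1 - a..1}\<close>.\<close>

lemma nn_integral_inverse_le:
  assumes u [measurable]: "u \<in> borel_measurable N" and u01: "\<And>x. x \<in> space N \<Longrightarrow> u x \<in> {0..1}"
    and b: "0 \<le> b" and a: "0 \<le> a" "a \<le> 1"
    and total: "emeasure N (space N) \<le> ennreal (b * a)"
    and superlevel: "\<And>r. 0 < r \<Longrightarrow> r < 1 \<Longrightarrow> emeasure N {x\<in>space N. r \<le> u x} \<le> ennreal (b * (1 - r))"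
  shows "(\<integral>\<^sup>+x. inverse (g (u x)) \<partial>N) \<le> ennreal b * recip_integral g (1 - a)"
proof -
  have fin: "finite_measure N"
    using total by (intro finite_measureI) (auto simp: top_unique)
  note [measurable] = measurable_compose_Icc[OF u u01]
  define h where "h s = inverse (g s) * indicator {1 - a..1} s" for s
  have h [measurable]: "h \<in> borel_measurable borel"
    unfolding h_def using a by (intro measurable_inverse_indicator) auto
  \<comment> \<open>The endpoints are added to the range of \<open>r\<close>: the bound at 1 is the
    limit of the bounds from the left, and \<open>r = 0\<close> forces \<open>a = 1\<close>, where
    the total mass bound applies.\<close>
  have superlevel_Icc: "emeasure N {x\<in>space N. r \<le> u x} \<le> ennreal (b * (1 - r))"
    if r: "1 - a \<le> r" "r \<le> 1" for r
  proof -
    consider "r = 1" | "r = 0" | "0 < r" "r < 1" using r a by fastforce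
    then show ?thesis
    proof cases
      case 1
      have "emeasure N {x\<in>space N. 1 \<le> u x} \<le> ennreal 0"
      proof (rule tendsto_lowerbound)
        show "((\<lambda>s. ennreal (b * (1 - s))) \<longlongrightarrow> ennreal 0) (at_left (1::real))"
          by (intro tendsto_ennrealI) (auto intro!: tendsto_eq_intros)
        have "\<forall>\<^sub>F s in at_left (1::real). s \<in> {0<..<1}"
          by (intro eventually_at_leftI[of 0]) auto
        then show "\<forall>\<^sub>F s in at_left 1. emeasure N {x\<in>space N. 1 \<le> u x} \<le> ennreal (b * (1 - s))"
        proof eventually_elim
          case (elim s)
          have "emeasure N {x\<in>space N. 1 \<le> u x} \<le> emeasure N {x\<in>space N. s \<le> u x}"
            using elim by (intro emeasure_mono) auto
          also have "\<dots> \<le> ennreal (b * (1 - s))"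
            using elim by (intro superlevel) auto
          finally show ?case .
        qed
      qed simp
      then show ?thesis using 1 by simp
    next
      case 2
      have "emeasure N {x\<in>space N. r \<le> u x} \<le> emeasure N (space N)"
        by (intro emeasure_space)
      then show ?thesis using 2 r a total by simp
    next
      case 3
      then show ?thesis by (intro superlevel)
    qed
  qed
  have "(\<integral>\<^sup>+x. inverse (g (u x)) \<partial>N)
      = (\<integral>\<^sup>+t\<in>{0..}. emeasure N {x\<in>space N. ennreal t < inverse (g (u x))} \<partial>lborel)"
    using fin by (intro nn_integral_layer_cake finite_measure.axioms(1)) measurable
  also have "\<dots> \<le> (\<integral>\<^sup>+t. ennreal b * (emeasure lborel {s. ennreal t < h s} * indicator {0..} t) \<partial>lborel)"
  proof (rule nn_integral_mono)
    fix t :: real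
    \<comment> \<open>\<open>S\<close> is the superlevel set of \<open>1/g\<close> at height
      \<open>t\<close>; it is upward closed in the unit interval.\<close>
    define S where "S = {s\<in>{0..1}. ennreal t < inverse (g s)}"
    have up: "s' \<in> S" if "s \<in> S" "s \<le> s'" "s' \<le> 1" for s s'
      using that inverse_mono[of s s'] by (auto simp: S_def)
    have hS: "{s. ennreal t < h s} = S \<inter> {1 - a..1}"
      using a by (auto simp: S_def h_def split: split_indicator)
    have hS_sets: "S \<inter> {1 - a..1} \<in> sets lborel"
      unfolding hS[symmetric] by measurable
    have uS: "{x\<in>space N. ennreal t < inverse (g (u x))} = {x\<in>space N. u x \<in> S}"
      using u01 by (auto simp: S_def)
    have "emeasure N {x\<in>space N. u x \<in> S} \<le> ennreal b * emeasure lborel (S \<inter> {1 - a..1})"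
    \<comment> \<open>If \<open>S\<close> reaches down to \<open>1 - a\<close>, its trimmed length
      is \<open>a\<close> and the total mass bound suffices. Otherwise \<open>S\<close> lies to the
      right of \<open>1 - a\<close> and the superlevel bound at its infimum is used.\<close>
    proof (cases "1 - a \<in> S")
      case True
      then have "S \<inter> {1 - a..1} = {1 - a..1}"
        using up by auto
      then have "emeasure lborel (S \<inter> {1 - a..1}) = ennreal a"
        using a by simp
      moreover have "emeasure N {x\<in>space N. u x \<in> S} \<le> emeasure N (space N)"
        by (intro emeasure_space)
      ultimately show ?thesis
        using total b by (simp add: ennreal_mult')
    next
      case False
      show ?thesis
      proof (cases "S = {}")
        case True then show ?thesis by simp
      next
        case nonempty: False
        define r where "r = Inf S"
        have above: "1 - a \<le> s" "s \<le> 1" if "s \<in> S" for s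
          using False up[OF that, of "1 - a"] a that by (force simp: S_def)+
        have bdd: "bdd_below S" using above by (intro bdd_belowI) auto
        have r: "1 - a \<le> r" "r \<le> 1"
          using above nonempty cInf_greatest[of S "1 - a"] cInf_lower2[OF _ _ bdd, of _ 1]
          by (auto simp: r_def)
        \<comment> \<open>Whether \<open>r\<close> itself belongs to \<open>S\<close> does not
          affect the length, so the half-open interval gives the full lower bound
          \<open>1 - r\<close>.\<close>
        have "{r<..1} \<subseteq> S"
        proof
          fix s assume "s \<in> {r<..1}"
          then obtain s' where "s' \<in> S" "s' < s"
            unfolding r_def using cInf_lessD[OF nonempty] by auto
          then show "s \<in> S" using up[of s' s] \<open>s \<in> {r<..1}\<close> by auto
        qed
        then have "emeasure lborel {r<..1} \<le> emeasure lborel (S \<inter> {1 - a..1})"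
          using hS_sets above by (intro emeasure_mono) auto
        then have "ennreal b * ennreal (1 - r) \<le> ennreal b * emeasure lborel (S \<inter> {1 - a..1})"
          using r by (intro mult_left_mono) auto
        then have "ennreal (b * (1 - r)) \<le> ennreal b * emeasure lborel (S \<inter> {1 - a..1})"
          using b by (simp only: ennreal_mult')
        moreover have "emeasure N {x\<in>space N. u x \<in> S} \<le> emeasure N {x\<in>space N. r \<le> u x}"
          using bdd by (intro emeasure_mono) (auto simp: r_def intro: cInf_lower)
        ultimately show ?thesis
          using superlevel_Icc[OF r] by (blast intro: order_trans)
      qed
    qed
    then show "emeasure N {x\<in>space N. ennreal t < inverse (g (u x))} * indicator {0..} t
        \<le> ennreal b * (emeasure lborel {s. ennreal t < h s} * indicator {0..} t)"
      unfolding uS hS by (auto split: split_indicator)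
  qed
  also have "\<dots> = ennreal b * (\<integral>\<^sup>+t\<in>{0..}. emeasure lborel {s. ennreal t < h s} \<partial>lborel)"
    by (intro nn_integral_cmult) measurable
  \<comment> \<open>The layer-cake formula is read backwards, now for \<open>h\<close> and Lebesgue
    measure.\<close>
  also have "(\<integral>\<^sup>+t\<in>{0..}. emeasure lborel {s. ennreal t < h s} \<partial>lborel) = (\<integral>\<^sup>+s. h s \<partial>lborel)"
    by (subst nn_integral_layer_cake) (auto intro: sigma_finite_lborel)
  finally show ?thesis by (simp add: h_def recip_integral_def)
qed

end

section \<open>From superlevel bounds to the estimates for u and G1\<close>

theorem theorem3p3:
  fixes M :: "'a measure"
    and G :: "'a \<Rightarrow> 'a measure"
    and b :: real
    and g :: "real \<Rightarrow> ennreal"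
    and u :: "'a \<Rightarrow> real"
  assumes "sigma_finite_kernel M G"
    and "b \<ge> 1"
    and "weak_max_principle M G b"
    and "continuous_on {0..1} g"
    and "antimono_on {0..1} g"
    and "\<forall>t\<in>{0..1}. 1 \<le> g t"
    and "\<forall>t\<in>{0<..1}. g t < \<infinity>"
    and "u \<in> borel_measurable M"
    and "\<forall>x\<in>space M. 0 \<le> u x"
    and "\<forall>x\<in>space M. ennreal (u x) + kernel_app G (\<lambda>y. g (u y)) x \<le> 1"
  shows "\<forall>x\<in>space M. u x > 0 \<longrightarrow>
      u x \<le> 1 - b * (1 - recip_integral_inv g (ennreal (inverse b) * kernel_app G (\<lambda>_. 1) x)) \<and>
      ennreal (inverse b) * kernel_app G (\<lambda>_. 1) x < recip_integral g (1 - inverse b) \<and>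
      ennreal (inverse b) * kernel_app G (\<lambda>_. 1) x \<in> {0..recip_integral g 0} \<and>
      0 < 1 - b * (1 - recip_integral_inv g (ennreal (inverse b) * kernel_app G (\<lambda>_. 1) x))"
proof -
  interpret antimono_weight g
    using assms(4-7) by unfold_locales auto
  note b = assms(2) and u [measurable] = assms(8)
  have ker: "sets (G x) = sets M" if "x \<in> space M" for x
    using assms(1) that by (simp add: sigma_finite_kernel_def)
  note ker_space = sets_eq_imp_space_eq[OF ker]
  have "ennreal (u x) \<le> 1" if "x \<in> space M" for x
    by (intro order_trans[OF _ bspec[OF assms(10) that]]) simp
  then have u01: "u x \<in> {0..1}" if "x \<in> space M" for x
    using assms(9) that by (simp add: ennreal_le_1)
  have Ggu: "kernel_app G (\<lambda>y. g (u y)) x \<le> ennreal (1 - u x)" if x: "x \<in> space M" for x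
  proof -
    have "kernel_app G (\<lambda>y. g (u y)) x \<le> 1 - ennreal (u x)"
      using assms(10) x by (subst ennreal_le_minus_iff) (auto simp: add.commute)
    also have "\<dots> = ennreal (1 - u x)"
      using u01[OF x] by (simp add: ennreal_minus flip: ennreal_1)
    finally show ?thesis .
  qed
  note [measurable] = measurable_compose_Icc[OF u u01]

  have superlevel: "(\<integral>\<^sup>+y. g (u y) * indicator {y\<in>space M. r \<le> u y} y \<partial>G x) \<le> ennreal (b * (1 - r))"
    if r: "0 < r" "r < 1" and x: "x \<in> space M" for r x
  proof -
    \<comment> \<open>The maximum principle concerns bounded real functions. Since
      \<open>r > 0\<close>, on \<open>r \<le> u y\<close> the value \<open>g (u y)\<close> is finite
      and at most \<open>g r\<close>, so passing to \<open>enn2real\<close> loses nothing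
      there.\<close>
    define f where "f y = enn2real (g (u y)) * indicator {y\<in>space M. r \<le> u y} y" for y
    have [measurable]: "f \<in> borel_measurable M"
      unfolding f_def by measurable
    have f_eq: "ennreal (f y) = g (u y) * indicator {y\<in>space M. r \<le> u y} y"
      if "y \<in> space M" for y
      using finite[of "u y"] u01[OF that] r by (auto simp: f_def split: split_indicator)
    have "f y \<in> {0..enn2real (g r)}" if "y \<in> space M" for y
      using antimono u01[OF that] finite[of r] r
      by (auto simp: f_def monotone_on_def intro!: enn2real_mono split: split_indicator)
    then have bdd: "bounded (f ` space M)"
      by (intro bounded_subset[OF bounded_closed_interval[of 0 "enn2real (g r)"]]) auto
    have Gf: "kernel_app G (\<lambda>y. ennreal (f y)) z
        = (\<integral>\<^sup>+y. g (u y) * indicator {y\<in>space M. r \<le> u y} y \<partial>G z)" if "z \<in> space M" for z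
      unfolding kernel_app_def using f_eq ker_space[OF that] by (intro nn_integral_cong) simp
    have "kernel_app G (\<lambda>y. ennreal (f y)) z \<le> ennreal (1 - r)"
      if z: "z \<in> space M" "f z > 0" for z
    proof -
      have "r \<le> u z" using z by (auto simp: f_def split: split_indicator_asm)
      have "kernel_app G (\<lambda>y. ennreal (f y)) z \<le> kernel_app G (\<lambda>y. g (u y)) z"
        unfolding Gf[OF z(1)] unfolding kernel_app_def
        by (intro nn_integral_mono) (auto split: split_indicator)
      also have "\<dots> \<le> ennreal (1 - u z)" by (rule Ggu[OF z(1)])
      also have "\<dots> \<le> ennreal (1 - r)" using \<open>r \<le> u z\<close> by (intro ennreal_leI) simp
      finally show ?thesis .
    qed
    then have "kernel_app G (\<lambda>y. ennreal (f y)) x \<le> ennreal (b * (1 - r))"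
      using r x bdd by (intro weak_max_principle_scaled[OF assms(3) ker]) (auto simp: f_def)
    then show ?thesis using Gf[OF x] by simp
  qed

  have key: "ennreal (inverse b) * kernel_app G (\<lambda>_. 1) x \<le> recip_integral g (1 - (1 - u x) / b)"
    if x: "x \<in> space M" for x
  proof -
    \<comment> \<open>\<open>N\<close> is the measure \<nu> of the overview.\<close>
    define N where "N = density (G x) (\<lambda>y. g (u y))"
    have [measurable_cong]: "sets (G x) = sets M" by (rule ker[OF x])
    have N: "sets N = sets M" "space N = space M" using ker[OF x] ker_space[OF x] by (auto simp: N_def)
    have "(\<integral>\<^sup>+y. g (u y) \<partial>G x) \<noteq> \<infinity>"
      using Ggu[OF x] by (auto simp: kernel_app_def top_unique)
    then have AE_finite: "AE y in G x. g (u y) \<noteq> \<infinity>"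
      by (intro nn_integral_PInf_AE) measurable
    \<comment> \<open>In \<^typ>\<open>ennreal\<close>, \<open>\<infinity> * inverse \<infinity> = 0\<close>, so the integrands agree only almost everywhere if \<open>g 0 = \<infinity>\<close>.\<close>
    have "kernel_app G (\<lambda>_. 1) x = (\<integral>\<^sup>+y. g (u y) * inverse (g (u y)) \<partial>G x)"
      unfolding kernel_app_def
    proof (rule nn_integral_cong_AE)
      show "AE y in G x. 1 = g (u y) * inverse (g (u y))"
        using AE_finite AE_space
      proof eventually_elim
        case (elim y)
        then have "1 \<le> g (u y)" using ge_one u01 ker_space[OF x] by simp
        then have "g (u y) \<noteq> 0" by auto
        then show ?case
          using elim by (simp add: ennreal_divide_self less_top flip: divide_ennreal_def)
      qed
    qed
    also have "\<dots> = (\<integral>\<^sup>+y. inverse (g (u y)) \<partial>N)"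
      unfolding N_def by (subst nn_integral_density) measurable
    \<comment> \<open>The comparison is applied with \<open>a = (1 - u x) / b\<close>, chosen so
      that \<open>b * a\<close> is the bound \<open>1 - u x\<close> on the total mass of
      \<open>N\<close>.\<close>
    also have "\<dots> \<le> ennreal b * recip_integral g (1 - (1 - u x) / b)"
    proof (rule nn_integral_inverse_le)
      show "u \<in> borel_measurable N" unfolding N_def by simp
      show "emeasure N (space N) \<le> ennreal (b * ((1 - u x) / b))"
        using Ggu[OF x] b unfolding N_def
        by (subst emeasure_density) (auto simp: kernel_app_def cong: nn_integral_cong)
      show "emeasure N {y\<in>space N. r \<le> u y} \<le> ennreal (b * (1 - r))" if "0 < r" "r < 1" for r
        using superlevel[OF that x] unfolding N(2)
        unfolding N_def by (subst emeasure_density) measurable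
    qed (use u01[OF x] u01 b N in \<open>auto simp: divide_simps\<close>)
    finally have "ennreal (inverse b) * kernel_app G (\<lambda>_. 1) x
        \<le> ennreal (inverse b) * (ennreal b * recip_integral g (1 - (1 - u x) / b))"
      by (intro mult_left_mono) auto
    also have "\<dots> = recip_integral g (1 - (1 - u x) / b)"
      using b by (simp flip: mult.assoc ennreal_mult')
    finally show ?thesis .
  qed

  show ?thesis
  proof (intro ballI impI)
    fix x assume x: "x \<in> space M" and pos: "u x > 0"
    define y where "y = ennreal (inverse b) * kernel_app G (\<lambda>_. 1) x"
    define p where "p = 1 - (1 - u x) / b"
    \<comment> \<open>Positivity of \<open>u x\<close> is exactly what makes \<open>p\<close> exceed
      \<open>1 - inverse b\<close>, and hence makes the bound on \<open>y\<close> strict.\<close>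
    have p: "p \<in> {0..1}" "1 - inverse b < p" and b1: "1 - inverse b \<in> {0..1}"
      using b pos u01[OF x] by (auto simp: p_def field_simps)
    have yp: "y \<le> recip_integral g p"
      using key[OF x] by (simp add: y_def p_def)
    also have "\<dots> < recip_integral g (1 - inverse b)"
      using p b1 by (simp add: recip_integral_less_iff)
    finally have y_less: "y < recip_integral g (1 - inverse b)" .
    also have "\<dots> \<le> recip_integral g 0"
      using b1 recip_integral_less_iff[of 0 "1 - inverse b"] by (simp add: not_less[symmetric])
    finally have y0: "y \<le> recip_integral g 0" by simp
    define t where "t = recip_integral_inv g y"
    have t: "t \<in> {0..1}" "recip_integral g t = y"
      using recip_integral_inv[OF y0] by (auto simp: t_def)
    \<comment> \<open>F(t) = \<open>y\<close> is at most F(p) and F is strictly decreasing. Solving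
      \<open>p \<le> t\<close> for \<open>u x\<close> gives the first inequality, and
      \<open>u x > 0\<close> then makes its right-hand side positive.\<close>
    have "p \<le> t"
      using yp t p recip_integral_less_iff[of p t] by (meson not_less)
    then have "u x \<le> 1 - b * (1 - t)"
      using b by (simp add: p_def field_simps)
    with pos y_less y0
    show "u x \<le> 1 - b * (1 - recip_integral_inv g y) \<and> y < recip_integral g (1 - inverse b) \<and>
        y \<in> {0..recip_integral g 0} \<and> 0 < 1 - b * (1 - recip_integral_inv g y)"
      by (simp add: t_def)
  qed
qed

end
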